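(* For each $\eta\in(0,\pi/3)$, the convex hull $\mathrm{co}(K_\eta)$ of the $\eta$-dragon curve $K_\eta$ is a polygon.
   Context: For $\eta\in(0,\pi/3)$ let $a=\frac{e^{-i\eta}}{2\cos\eta}$, $f_1(z)=az$, $f_2(z)=1-\bar a z$ ($z\in\mathbb{C}$). The $\eta$-dragon curve $K_\eta$ is the unique nonempty compact set $K_\eta\subset\mathbb{C}$ with $K_\eta=f_1(K_\eta)\cup f_2(K_\eta)$. *)

theory Defs
  imports "HOL-Analysis.Analysis"
begin

definition dragon_a :: "real \<Rightarrow> complex" where
  "dragon_a \<eta> = cis (- \<eta>) / complex_of_real (2 * cos \<eta>)"

definition dragon_f1 :: "real \<Rightarrow> complex \<Rightarrow> complex" where
  "dragon_f1 \<eta> z = dragon_a \<eta> * z"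

definition dragon_f2 :: "real \<Rightarrow> complex \<Rightarrow> complex" where
  "dragon_f2 \<eta> z = 1 - cnj (dragon_a \<eta>) * z"

definition dragon :: "real \<Rightarrow> complex set" where
  "dragon \<eta> = (THE K. compact K \<and> K \<noteq> {} \<and>
                  K = dragon_f1 \<eta> ` K \<union> dragon_f2 \<eta> ` K)"

definition convex_polygon :: "complex set \<Rightarrow> bool" where
  "convex_polygon S \<longleftrightarrow> polytope S \<and> interior S \<noteq> {}"

end

theory Submission
  imports Defs
begin

text \<open>
  Put \<open>R = \<bar>a\<bar>\<^sup>2\<close>. Since \<open>Re a = 1/2\<close>, the values \<open>x k\<close> of a real-linear functional at \<open>a ^ k\<close> satisfy
  \<open>x (k + 2) = x (k + 1) - R * x k\<close>. Let \<open>p\<close> be the fixed point of \<open>f\<^sub>2 f\<^sub>2 f\<^sub>1 f\<^sub>1\<close>, and let \<open>W\<close> consist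
  of the points \<open>f\<^sub>1\<^sup>n p\<close>, \<open>f\<^sub>2 f\<^sub>1\<^sup>n p\<close> and \<open>f\<^sub>2 f\<^sub>2 f\<^sub>1 p\<close>, all of which lie in the dragon curve. Comparing
  support functions by means of the recurrence shows that \<open>f\<^sub>1\<close> and \<open>f\<^sub>2\<close> map \<open>W\<close> into its convex hull, so
  this hull contains the dragon curve. The two sequences in \<open>W\<close> spiral around their limits \<open>0\<close> and \<open>1\<close>,
  which are therefore interior to the hulls of the sequences, so finitely many points of \<open>W\<close> span its hull.
\<close>

section \<open>Attractors of iterated function systems\<close>

definition contractive_ifs :: "('a::metric_space \<Rightarrow> 'a) set \<Rightarrow> bool" where
  "contractive_ifs F \<longleftrightarrow> (\<exists>c<1. \<forall>f\<in>F. c-lipschitz_on UNIV f)"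

definition attractor :: "('a::metric_space \<Rightarrow> 'a) set \<Rightarrow> 'a set \<Rightarrow> bool" where
  "attractor F K \<longleftrightarrow> compact K \<and> K \<noteq> {} \<and> K = (\<Union>f\<in>F. f ` K)"

lemma infdist_image_le:
  fixes f :: "'a::heine_borel \<Rightarrow> 'a"
  assumes "c-lipschitz_on UNIV f" and L: "closed L" "L \<noteq> {}" "f ` L \<subseteq> L"
  shows "infdist (f w) L \<le> c * infdist w L"
proof -
  obtain l where l: "l \<in> L" "infdist w L = dist w l"
    using infdist_attains_inf L(1,2) by blast
  then have "infdist (f w) L \<le> dist (f w) (f l)"
    using L(3) by (intro infdist_le) auto
  also have "\<dots> \<le> c * dist w l"
    using lipschitz_onD[OF assms(1)] by simp
  finally show ?thesis
    using l(2) by simp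
qed

text \<open>At a point of \<open>K\<close> farthest from \<open>L\<close> the distance to \<open>L\<close> is at most \<open>c\<close> times itself.\<close>

lemma compact_self_covered_subset:
  fixes F :: "('a::heine_borel \<Rightarrow> 'a) set"
  assumes "contractive_ifs F"
    and K: "compact K" "K \<subseteq> (\<Union>f\<in>F. f ` K)"
    and L: "closed L" "L \<noteq> {}" "\<And>f. f \<in> F \<Longrightarrow> f ` L \<subseteq> L"
  shows "K \<subseteq> L"
proof (cases "K = {}")
  case False
  obtain c where c: "c < 1" "\<And>f. f \<in> F \<Longrightarrow> c-lipschitz_on UNIV f"
    using assms(1) by (auto simp: contractive_ifs_def)
  have "continuous_on K (\<lambda>z. infdist z L)"
    by (intro continuous_intros)
  then obtain z where z: "z \<in> K" "\<And>y. y \<in> K \<Longrightarrow> infdist y L \<le> infdist z L"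
    using continuous_attains_sup[OF K(1) False] by blast
  obtain f w where f: "f \<in> F" and w: "w \<in> K" "z = f w"
    using z(1) K(2) by blast
  have "infdist z L \<le> c * infdist w L"
    unfolding w(2) using f c(2) L by (intro infdist_image_le)
  also have "\<dots> \<le> c * infdist z L"
    using z(2) w(1) lipschitz_on_nonneg[OF c(2)[OF f]] by (intro mult_left_mono)
  finally have "(1 - c) * infdist z L \<le> 0"
    by (simp add: algebra_simps)
  then have "infdist z L \<le> 0"
    using c(1) by (simp add: mult_le_0_iff)
  then have "infdist y L = 0" if "y \<in> K" for y
    using z(2)[OF that] infdist_nonneg[of y L] by linarith
  then show ?thesis
    using in_closed_iff_infdist_zero[OF L(1,2)] by blast
qed simp

lemma fixed_point_mem_closed_invariant:
  fixes f :: "'a::heine_borel \<Rightarrow> 'a"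
  assumes "c-lipschitz_on UNIV f" "c < 1" "f p = p"
    and L: "closed L" "L \<noteq> {}" "f ` L \<subseteq> L"
  shows "p \<in> L"
proof -
  have "contractive_ifs {f}"
    using assms by (auto simp: contractive_ifs_def)
  then have "{p} \<subseteq> L"
    by (rule compact_self_covered_subset) (use assms(3) L in auto)
  then show ?thesis
    by simp
qed

lemma attractor_subset_invariant:
  fixes F :: "('a::heine_borel \<Rightarrow> 'a) set"
  assumes "contractive_ifs F" "attractor F K"
    and "closed L" "L \<noteq> {}" "\<And>f. f \<in> F \<Longrightarrow> f ` L \<subseteq> L"
  shows "K \<subseteq> L"
proof (rule compact_self_covered_subset[OF assms(1) _ _ assms(3-5)])
  show "compact K" "K \<subseteq> (\<Union>f\<in>F. f ` K)"
    using assms(2) by (simp_all add: attractor_def)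
qed

lemma attractor_imp_closed: "attractor F K \<Longrightarrow> closed K"
  unfolding attractor_def by (blast intro: compact_imp_closed)

lemma attractor_nonempty: "attractor F K \<Longrightarrow> K \<noteq> {}"
  unfolding attractor_def by blast

lemma attractor_image_subset: "attractor F K \<Longrightarrow> f \<in> F \<Longrightarrow> f ` K \<subseteq> K"
  unfolding attractor_def by blast

lemma attractor_unique:
  fixes F :: "('a::heine_borel \<Rightarrow> 'a) set"
  assumes "contractive_ifs F" "attractor F K" "attractor F L"
  shows "K = L"
proof -
  have "A \<subseteq> B" if "attractor F A" "attractor F B" for A B
    using assms(1) that(1)
  proof (rule attractor_subset_invariant)
    show "closed B" "B \<noteq> {}"
      using attractor_imp_closed[OF that(2)] attractor_nonempty[OF that(2)] .
    show "f ` B \<subseteq> B" if "f \<in> F" for f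
      using attractor_image_subset[OF \<open>attractor F B\<close> that] .
  qed
  then show ?thesis
    using assms(2,3) by blast
qed

inductive_set ifs_orbit :: "('a \<Rightarrow> 'a) set \<Rightarrow> 'a \<Rightarrow> 'a set" for F p where
  base: "p \<in> ifs_orbit F p"
| step: "z \<in> ifs_orbit F p \<Longrightarrow> f \<in> F \<Longrightarrow> f z \<in> ifs_orbit F p"

lemma bounded_ifs_orbit:
  fixes F :: "('a::metric_space \<Rightarrow> 'a) set"
  assumes "contractive_ifs F" "finite F"
  shows "bounded (ifs_orbit F p)"
proof -
  obtain c where c: "c < 1" "\<And>f. f \<in> F \<Longrightarrow> c-lipschitz_on UNIV f"
    using assms(1) by (auto simp: contractive_ifs_def)
  define D where "D = (\<Sum>f\<in>F. dist p (f p))"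
  have D: "dist p (f p) \<le> D" if "f \<in> F" for f
    unfolding D_def using that assms(2) by (intro member_le_sum) auto
  have "0 \<le> D"
    unfolding D_def by (intro sum_nonneg) simp
  have "dist p z \<le> D / (1 - c)" if "z \<in> ifs_orbit F p" for z
    using that
  proof induction
    case base
    then show ?case
      using \<open>0 \<le> D\<close> c(1) by simp
  next
    case (step z f)
    have "dist p (f z) \<le> dist p (f p) + dist (f p) (f z)"
      by (rule dist_triangle)
    also have "\<dots> \<le> D + c * dist p z"
      using D[OF step(2)] lipschitz_onD[OF c(2)[OF step(2)], of p z] by simp
    also have "\<dots> \<le> D + c * (D / (1 - c))"
      using step lipschitz_on_nonneg[OF c(2)[OF step(2)]] by (intro add_left_mono mult_left_mono)
    also have "\<dots> = D / (1 - c)"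
      using c(1) by (simp add: field_simps)
    finally show ?case .
  qed
  then show ?thesis
    unfolding bounded_def by blast
qed

lemma attractor_closure_ifs_orbit:
  fixes F :: "('a::heine_borel \<Rightarrow> 'a) set"
  assumes "contractive_ifs F" "finite F" and p: "g \<in> F" "g p = p"
  shows "attractor F (closure (ifs_orbit F p))"
proof -
  let ?O = "ifs_orbit F p" and ?K = "closure (ifs_orbit F p)"
  have cont: "continuous_on S f" if "f \<in> F" for f S
    using assms(1) that lipschitz_on_continuous_on continuous_on_subset
    unfolding contractive_ifs_def by blast
  have K: "compact ?K"
    using bounded_ifs_orbit[OF assms(1,2)] compact_closure by blast
  have "f ` ?K \<subseteq> ?K" if "f \<in> F" for f
    using that closure_subset[of ?O]
    by (intro image_closure_subset cont) (auto intro: ifs_orbit.step)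
  moreover have "?K \<subseteq> (\<Union>f\<in>F. f ` ?K)"
  proof (rule closure_minimal)
    have "z \<in> (\<Union>f\<in>F. f ` ?O)" if "z \<in> ?O" for z
      using that
    proof cases
      case base
      then show ?thesis
        using p ifs_orbit.base[of p F] by (metis UN_I imageI)
    qed auto
    then show "?O \<subseteq> (\<Union>f\<in>F. f ` ?K)"
      using closure_subset[of ?O] by blast
    show "closed (\<Union>f\<in>F. f ` ?K)"
      using assms(2) K cont by (intro compact_imp_closed compact_UN compact_continuous_image)
  qed
  moreover have "?K \<noteq> {}"
    using ifs_orbit.base by fastforce
  ultimately show ?thesis
    using K by (auto simp: attractor_def)
qed

theorem attractor_ex1:
  fixes F :: "('a::heine_borel \<Rightarrow> 'a) set"
  assumes "contractive_ifs F" "finite F" "F \<noteq> {}"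
  shows "\<exists>!K. attractor F K"
proof -
  obtain g where g: "g \<in> F"
    using assms(3) by blast
  then obtain c where "c < 1" "c-lipschitz_on UNIV g"
    using assms(1) by (auto simp: contractive_ifs_def)
  then obtain p where "g p = p"
    using banach_fix_type[of c g] by (auto simp: lipschitz_on_def)
  then show ?thesis
    using attractor_closure_ifs_orbit[OF assms(1,2) g] attractor_unique[OF assms(1)] by blast
qed

lemma affine_image_convex_hull:
  fixes f :: "'a::real_vector \<Rightarrow> 'b::real_vector"
  assumes "linear (\<lambda>x. f x - f 0)"
  shows "f ` (convex hull S) = convex hull (f ` S)"
proof -
  have f: "f ` T = (\<lambda>y. f 0 + y) ` (\<lambda>x. f x - f 0) ` T" for T
    by (simp add: image_image)
  show ?thesis
    unfolding f by (simp only: convex_hull_translation convex_hull_linear_image[OF assms])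
qed

lemma convex_hull_attractor_eq:
  fixes F :: "('a::euclidean_space \<Rightarrow> 'a) set"
  assumes F: "contractive_ifs F" "\<And>f. f \<in> F \<Longrightarrow> linear (\<lambda>x. f x - f 0)"
    and K: "attractor F K"
    and W: "W \<noteq> {}" "W \<subseteq> K" "closed (convex hull W)"
    and image: "\<And>f. f \<in> F \<Longrightarrow> f ` W \<subseteq> convex hull W"
  shows "convex hull K = convex hull W"
proof
  have "f ` (convex hull W) \<subseteq> convex hull W" if "f \<in> F" for f
    using image[OF that] by (simp add: affine_image_convex_hull F that hull_minimal)
  then have "K \<subseteq> convex hull W"
    using W by (intro attractor_subset_invariant[OF F(1) K]) auto
  then show "convex hull K \<subseteq> convex hull W"
    by (simp add: hull_minimal)
  show "convex hull W \<subseteq> convex hull K"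
    using W(2) by (rule hull_mono)
qed

section \<open>Convex hulls\<close>

lemma mem_closed_convex_hullI:
  fixes S :: "'a::euclidean_space set"
  assumes "closed (convex hull S)"
    and "\<And>u c. (\<And>s. s \<in> S \<Longrightarrow> u \<bullet> s \<le> c) \<Longrightarrow> u \<bullet> y \<le> c"
  shows "y \<in> convex hull S"
proof -
  have "y \<in> {x. u \<bullet> x \<le> c}" if "convex hull S \<subseteq> {x. u \<bullet> x \<le> c}" for u c
    using assms(2)[of u c] that hull_subset[of S convex] by auto
  then have "y \<in> \<Inter>{h. convex hull S \<subseteq> h \<and> (\<exists>u c. h = {x. u \<bullet> x \<le> c})}"
    by blast
  then show ?thesis
    using convex_halfspace_intersection[OF assms(1) convex_convex_hull] by simp
qed

lemma mem_interior_convex_hullI: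
  fixes S :: "'a::euclidean_space set"
  assumes descent: "\<And>u. u \<noteq> 0 \<Longrightarrow> \<exists>y\<in>S. u \<bullet> y < u \<bullet> x"
  shows "x \<in> interior (convex hull S)"
proof (rule ccontr)
  let ?C = "convex hull S"
  assume x: "x \<notin> interior ?C"
  have "interior ?C \<noteq> {}"
  proof
    assume "interior ?C = {}"
    then obtain v c where v: "v \<noteq> 0" "?C \<subseteq> {y. v \<bullet> y = c}"
      using empty_interior_subset_hyperplane[OF convex_convex_hull] by metis
    then have "v \<bullet> y = c" if "y \<in> S" for y
      using that hull_subset[of S convex] by auto
    then show False
      using descent[of v] descent[of "- v"] v(1) by force
  qed
  then obtain u b where u: "u \<noteq> 0" "u \<bullet> x \<le> b" "\<And>y. y \<in> interior ?C \<Longrightarrow> b \<le> u \<bullet> y"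
    using separating_hyperplane_sets[of "{x}" "interior ?C"] x by auto
  have "S \<subseteq> closure (interior ?C)"
    using \<open>interior ?C \<noteq> {}\<close> hull_subset[of S convex] closure_subset[of ?C]
    by (auto simp: convex_closure_interior)
  also have "\<dots> \<subseteq> {y. b \<le> u \<bullet> y}"
    using u(3) by (intro closure_minimal) (auto simp: closed_halfspace_ge)
  finally show False
    using descent[OF u(1)] u(2) by fastforce
qed

lemma interior_convex_hull_finite_subset:
  fixes S :: "'a::euclidean_space set"
  assumes "x \<in> interior (convex hull S)"
  obtains T where "finite T" "T \<subseteq> S" "x \<in> interior (convex hull T)"
proof -
  obtain a b where ab: "cbox a b \<subseteq> interior (convex hull S)" "x \<in> box a b"
    using open_contains_cbox[OF open_interior assms] by metis
  obtain E where E: "finite E" "cbox a b = convex hull E"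
    using polytope_interval[of a b] by (auto simp: polytope_def)
  have "\<forall>e\<in>E. \<exists>T. finite T \<and> T \<subseteq> S \<and> e \<in> convex hull T"
  proof
    fix e assume "e \<in> E"
    then have "e \<in> cbox a b"
      by (simp add: E(2) hull_inc)
    then have "e \<in> convex hull S"
      using ab(1) interior_subset[of "convex hull S"] by blast
    then show "\<exists>T. finite T \<and> T \<subseteq> S \<and> e \<in> convex hull T"
      unfolding caratheodory[of S] by blast
  qed
  then obtain T where T: "\<And>e. e \<in> E \<Longrightarrow> finite (T e) \<and> T e \<subseteq> S \<and> e \<in> convex hull T e"
    by metis
  have "E \<subseteq> convex hull (\<Union>(T ` E))"
    using T hull_mono[of "T _" "\<Union>(T ` E)" convex] by blast
  then have "cbox a b \<subseteq> convex hull (\<Union>(T ` E))"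
    by (simp add: E(2) hull_minimal)
  then have "box a b \<subseteq> interior (convex hull (\<Union>(T ` E)))"
    using box_subset_cbox[of a b] by (intro interior_maximal) auto
  with ab(2) show thesis
    using E(1) T by (intro that[of "\<Union>(T ` E)"]) auto
qed

lemma polytope_convex_hull_convergent_sequence:
  fixes p :: "nat \<Rightarrow> 'a::euclidean_space"
  assumes lim: "p \<longlonglongrightarrow> l" and l: "l \<in> interior (convex hull (range p))"
  shows "polytope (convex hull (range p))"
proof -
  obtain T where T: "finite T" "T \<subseteq> range p" "l \<in> interior (convex hull T)"
    using interior_convex_hull_finite_subset[OF l] .
  obtain N where N: "\<And>n. n \<ge> N \<Longrightarrow> p n \<in> interior (convex hull T)"
    using topological_tendstoD[OF lim open_interior T(3)] by (auto simp: eventually_sequentially)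
  let ?V = "T \<union> p ` {..<N}"
  have "p n \<in> convex hull ?V" for n
  proof (cases "n < N")
    case True
    then show ?thesis
      by (intro hull_inc) auto
  next
    case False
    then have "p n \<in> convex hull T"
      using N interior_subset by force
    then show ?thesis
      using hull_mono[of T ?V convex] by blast
  qed
  then have "convex hull (range p) = convex hull ?V"
    using T(2) by (intro antisym hull_minimal hull_mono) auto
  then show ?thesis
    using T(1) by (simp add: polytope_convex_hull)
qed

lemma polytope_convex_hull_Un:
  assumes "polytope (convex hull S)" "polytope (convex hull T)"
  shows "polytope (convex hull (S \<union> T))"
proof -
  obtain V W where V: "finite V" "convex hull S = convex hull V"
    and W: "finite W" "convex hull T = convex hull W"
    using assms by (auto simp: polytope_def)
  then have "convex hull (S \<union> T) = convex hull (V \<union> W)"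
    using hull_Un[of convex S T] hull_Un[of convex V W] by (simp add: convex_Inter)
  then show ?thesis
    using V(1) W(1) by (simp add: polytope_convex_hull)
qed

section \<open>Logarithmic spirals\<close>

text \<open>Steps of length \<open>\<theta> < \<pi>\<close> cannot jump over the interval from \<open>\<pi> / 2\<close> to \<open>3 * \<pi> / 2\<close>.\<close>

lemma exists_cos_neg:
  fixes \<theta> \<phi> :: real
  assumes "0 < \<theta>" "\<theta> < pi"
  shows "\<exists>n. cos (\<phi> + of_nat n * \<theta>) < 0"
proof -
  obtain k where "\<phi> < of_nat k * (2 * pi)"
    using reals_Archimedean3[of "2 * pi"] by auto
  define \<psi> where "\<psi> = \<phi> - of_nat k * (2 * pi)"
  have \<psi>: "\<psi> \<le> pi / 2"
    using \<open>\<phi> < of_nat k * (2 * pi)\<close> pi_gt_zero unfolding \<psi>_def by linarith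
  obtain N where "pi / 2 - \<psi> < of_nat N * \<theta>"
    using reals_Archimedean3[OF assms(1)] by blast
  then obtain n where n: "\<psi> + of_nat n * \<theta> \<le> pi / 2" "pi / 2 < \<psi> + of_nat (Suc n) * \<theta>"
    using ex_least_nat_less[of "\<lambda>n. pi / 2 < \<psi> + of_nat n * \<theta>" N] \<psi> by force
  have "0 < cos (\<psi> + of_nat (Suc n) * \<theta> - pi)"
    using n assms(2) by (intro cos_gt_zero_pi) (auto simp: algebra_simps)
  then have "cos (\<psi> + of_nat (Suc n) * \<theta>) < 0"
    by simp
  moreover have "cos (\<psi> + t) = cos (\<phi> + t)" for t
    using cos.minus_of_nat[of "\<phi> + t" k] by (simp add: \<psi>_def algebra_simps)
  ultimately have "cos (\<phi> + of_nat (Suc n) * \<theta>) < 0"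
    by simp
  then show ?thesis ..
qed

lemma exists_power_Re_neg:
  fixes a w :: complex
  assumes "Im a \<noteq> 0" "w \<noteq> 0"
  shows "\<exists>n. Re (w * a ^ n) < 0"
proof -
  have Re_eq: "Re (w * a ^ n) = norm w * norm a ^ n * cos (Arg w + of_nat n * Arg a)" for n
    by (metis DeMoivre2 Re_rcis rcis_cmod_Arg rcis_mult)
  obtain n where n: "cos (Arg w + of_nat n * Arg a) < 0"
  proof (cases "0 < Im a")
    case True
    then show thesis
      using exists_cos_neg[of "Arg a" "Arg w"] Arg_lt_pi that by blast
  next
    case False
    then have "0 < - Arg a" "- Arg a < pi"
      using assms(1) Arg_less_0[of a] Arg_bounded[of a] by auto
    then obtain n where "cos (- Arg w + of_nat n * (- Arg a)) < 0"
      using exists_cos_neg by blast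
    moreover have "- Arg w + of_nat n * (- Arg a) = - (Arg w + of_nat n * Arg a)"
      by simp
    ultimately show thesis
      using that[of n] by (metis cos_minus)
  qed
  moreover have "0 < norm w * norm a ^ n"
    using assms by (intro mult_pos_pos zero_less_power) auto
  ultimately show ?thesis
    unfolding Re_eq by (blast intro: mult_pos_neg)
qed

lemma spiral_center_interior_convex_hull:
  fixes a c z :: complex
  assumes "Im a \<noteq> 0" "c \<noteq> 0"
  shows "z \<in> interior (convex hull (range (\<lambda>n. z + c * a ^ n)))"
proof (rule mem_interior_convex_hullI)
  fix u :: complex assume "u \<noteq> 0"
  then obtain n where "Re ((cnj u * c) * a ^ n) < 0"
    using exists_power_Re_neg[OF assms(1), of "cnj u * c"] assms(2) by auto
  then have "u \<bullet> (z + c * a ^ n) < u \<bullet> z"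
    by (simp add: inner_add_right inner_complex_def algebra_simps)
  then show "\<exists>y\<in>range (\<lambda>n. z + c * a ^ n). u \<bullet> y < u \<bullet> z"
    by blast
qed

lemma polytope_convex_hull_spiral:
  fixes a c z :: complex
  assumes "Im a \<noteq> 0" "norm a < 1" "c \<noteq> 0"
  shows "polytope (convex hull (range (\<lambda>n. z + c * a ^ n)))"
proof (rule polytope_convex_hull_convergent_sequence)
  have "(\<lambda>n. z + c * a ^ n) \<longlonglongrightarrow> z + c * 0"
    using assms(2) by (intro tendsto_intros LIMSEQ_power_zero)
  then show "(\<lambda>n. z + c * a ^ n) \<longlonglongrightarrow> z"
    by simp
  show "z \<in> interior (convex hull (range (\<lambda>n. z + c * a ^ n)))"
    using assms by (intro spiral_center_interior_convex_hull)
qed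

section \<open>The recurrence satisfied by linear functionals of powers\<close>

text \<open>In the application \<open>x k\<close> is the value at \<open>a ^ k\<close> of a linear functional bounded by
  \<open>M / (1 - R\<^sup>2)\<close> on the vertices; \<open>le_M\<close>, \<open>spiral1_le\<close> and \<open>apex_le\<close> are its bounds at
  \<open>spiral0 k\<close>, \<open>spiral1 k\<close> and \<open>apex\<close>.\<close>

locale damped_recurrence =
  fixes R M :: real and x :: "nat \<Rightarrow> real"
  assumes R_pos: "0 < R" and R_less_1: "R < 1"
    and recurrence: "x (Suc (Suc k)) = x (Suc k) - R * x k"
    and M_nonneg: "0 \<le> M"
    and le_M: "x (Suc k) \<le> M"
begin

lemma R_square_less_1: "R\<^sup>2 < 1"
  using R_pos R_less_1 by (simp add: power_less_one_iff)

lemma x_2: "x 2 = x 1 - R * x 0"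
  using recurrence[of 0] by (simp add: numeral_eq_Suc)

lemma x_3: "x 3 = (1 - R) * x 1 - R * x 0"
proof -
  have "x 3 = x 2 - R * x 1"
    using recurrence[of 1] by (simp add: numeral_eq_Suc)
  then show ?thesis
    by (simp add: x_2 algebra_simps)
qed

lemma x_4: "x 4 = (1 - 2 * R) * x 1 - R * (1 - R) * x 0"
proof -
  have "x 4 = x 3 - R * x 2"
    using recurrence[of 2] by (simp add: numeral_eq_Suc)
  then show ?thesis
    by (simp add: x_2 x_3 algebra_simps)
qed

lemma lower_bound_of_rising_start:
  assumes "x 0 \<le> x 1"
  shows "min (x 1) (- R * M) \<le> x (Suc k)"
proof (induction k)
  case (Suc k)
  have le_M': "x j \<le> M" for j
    using le_M[of 0] le_M[of "j - 1"] assms by (cases j) auto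
  have R_le: "R * x j \<le> R * M" for j
    using le_M' R_pos by (intro mult_left_mono) auto
  consider (nonneg) "0 \<le> x (Suc k)" | (rising) "x (Suc k) < 0" "x k \<le> 0"
    | (falling) "x (Suc k) < 0" "0 < x k" by linarith
  then show ?case
  proof cases
    case nonneg
    then show ?thesis
      using recurrence[of k] R_le[of k] by simp
  next
    case rising
    then have "R * x k \<le> 0"
      using R_pos by (simp add: mult_le_0_iff)
    then show ?thesis
      using recurrence[of k] Suc by simp
  next
    case falling
    then obtain j where j: "k = Suc j"
      using assms by (cases k) auto
    have "x (Suc (Suc k)) = (1 - R) * x k - R * x j"
      using recurrence[of k] recurrence[of j] by (simp add: j algebra_simps)
    moreover have "0 \<le> (1 - R) * x k"
      using R_less_1 falling by simp
    ultimately show ?thesis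
      using R_le[of j] by simp
  qed
qed simp

lemma f1_spiral1_0_le_of_rising_start:
  assumes "x 0 \<le> x 1"
  shows "(1 - R\<^sup>2) * x 1 - R * x 1 \<le> M"
proof (cases "0 \<le> x 1")
  case True
  then have "0 \<le> R\<^sup>2 * x 1" "0 \<le> R * x 1"
    using R_pos by auto
  then show ?thesis
    using le_M[of 0] by (simp add: algebra_simps)
next
  case False
  then have "0 \<le> R * (1 - R) * (- x 0 - x 1)"
    using R_pos R_less_1 assms by simp
  moreover have "x 4 \<le> M"
    using le_M[of 3] by (simp add: numeral_eq_Suc)
  ultimately show ?thesis
    by (simp add: x_4 power2_eq_square algebra_simps)
qed

lemma f1_spiral1_le_of_rising_start:
  assumes "x 0 \<le> x 1"
  shows "(1 - R\<^sup>2) * x 1 - R * x (Suc k) \<le> M"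
proof -
  consider (above_start) "x 1 \<le> x (Suc k)" | (above_bound) "- R * M \<le> x (Suc k)"
    using lower_bound_of_rising_start[OF assms, of k] by linarith
  then show ?thesis
  proof cases
    case above_start
    then have "R * x 1 \<le> R * x (Suc k)"
      using R_pos by simp
    then show ?thesis
      using f1_spiral1_0_le_of_rising_start[OF assms] by linarith
  next
    case above_bound
    then have "R * (- R * M) \<le> R * x (Suc k)"
      using R_pos by (intro mult_left_mono) auto
    moreover have "(1 - R\<^sup>2) * x 1 \<le> (1 - R\<^sup>2) * M"
      using R_square_less_1 le_M[of 0] by (intro mult_left_mono) auto
    ultimately show ?thesis
      by (simp add: power2_eq_square algebra_simps)
  qed
qed

lemma f2_apex_le_of_rising_start:
  assumes "x 0 \<le> x 1"
  shows "(1 - R\<^sup>2) * (1 - R) * x 0 - R\<^sup>2 * (x 0 - x 1) \<le> M"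
proof -
  have bounds: "0 \<le> 1 - R" "0 \<le> 1 - R\<^sup>2" "0 \<le> 1 + R - R\<^sup>2" "0 \<le> 1 - R + R\<^sup>2"
    using R_pos R_less_1 R_square_less_1 by auto
  consider (nonneg) "0 \<le> x 0" | (crossing) "x 0 \<le> 0" "0 \<le> x 1" | (nonpos) "x 1 \<le> 0"
    by linarith
  then show ?thesis
  proof cases
    case nonneg
    then have "(1 - R\<^sup>2) * (1 - R) * x 0 \<le> (1 - R\<^sup>2) * 1 * x 1"
      using R_pos bounds assms by (intro mult_mono) auto
    moreover have "0 \<le> R\<^sup>2 * x 0"
      using nonneg by simp
    ultimately show ?thesis
      using le_M[of 0] by (simp add: algebra_simps)
  next
    case crossing
    then have "0 \<le> (1 - R\<^sup>2) * x 1 + (1 - R) * (1 + R - R\<^sup>2) * (- x 0)"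
      using bounds by (intro add_nonneg_nonneg mult_nonneg_nonneg) auto
    moreover have "x 2 \<le> M"
      using le_M[of 1] by (simp add: numeral_eq_Suc)
    ultimately show ?thesis
      by (simp add: x_2 power2_eq_square algebra_simps)
  next
    case nonpos
    then have "0 \<le> (1 - R) * (1 + R - R\<^sup>2) * (x 1 - x 0)" "0 \<le> R * (1 - R + R\<^sup>2) * (- x 1)"
      using bounds R_pos assms by (intro mult_nonneg_nonneg; simp)+
    moreover have "x 3 \<le> M"
      using le_M[of 2] by (simp add: numeral_eq_Suc)
    ultimately show ?thesis
      by (simp add: x_3 power2_eq_square algebra_simps)
  qed
qed

end

locale dragon_support = damped_recurrence +
  assumes spiral1_le: "(1 - R\<^sup>2) * x 0 - R * x k \<le> M"
    and apex_le: "(1 - R\<^sup>2) * x 1 + R\<^sup>2 * x 0 \<le> M"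
begin

lemma f1_spiral1_le: "(1 - R\<^sup>2) * x 1 - R * x (Suc k) \<le> M"
proof (cases "x 0 \<le> x 1")
  case True
  then show ?thesis
    by (rule f1_spiral1_le_of_rising_start)
next
  case False
  then have "(1 - R\<^sup>2) * x 1 \<le> (1 - R\<^sup>2) * x 0"
    using R_square_less_1 by (intro mult_left_mono) auto
  then show ?thesis
    using spiral1_le[of "Suc k"] by linarith
qed

lemma f2_spiral1_0_le: "(1 - R\<^sup>2) * x 1 + R * (x 0 - x 1) \<le> M"
proof -
  consider (rising) "x 0 \<le> x 1" | (negative) "x 1 < x 0" "x 1 < 0"
    | (small) "0 \<le> x 1" "x 1 \<le> (1 - R) * x 0" | (large) "(1 - R) * x 0 \<le> x 1" by linarith
  then show ?thesis
  proof cases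
    case rising
    then have "R * (x 0 - x 1) \<le> 0"
      using R_pos by (simp add: mult_le_0_iff)
    moreover have "(1 - R\<^sup>2) * x 1 \<le> (1 - R\<^sup>2) * M"
      using R_square_less_1 le_M[of 0] by (intro mult_left_mono) auto
    moreover have "0 \<le> R\<^sup>2 * M"
      using M_nonneg by simp
    ultimately show ?thesis
      by (simp add: algebra_simps)
  next
    case negative
    then have "R * x 1 < 0"
      using R_pos by (simp add: mult_less_0_iff)
    then have "0 \<le> (1 - R) * (x 0 - x 1 - R * x 1)"
      using R_less_1 negative by simp
    then show ?thesis
      using spiral1_le[of 2] by (simp add: x_2 power2_eq_square algebra_simps)
  next
    case small
    then have "0 \<le> 2 * R\<^sup>2 * x 1"
      by simp
    then show ?thesis
      using spiral1_le[of 3] small by (simp add: x_3 power2_eq_square algebra_simps)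
  next
    case large
    then have "0 \<le> R * (x 1 - (1 - R) * x 0)"
      using R_pos by simp
    then show ?thesis
      using apex_le by (simp add: power2_eq_square algebra_simps)
  qed
qed

lemma f2_apex_le: "(1 - R\<^sup>2) * (1 - R) * x 0 - R\<^sup>2 * (x 0 - x 1) \<le> M"
proof -
  consider (rising) "x 0 \<le> x 1" | (falling_nonneg) "x 1 \<le> x 0" "0 \<le> x 0"
    | (falling_neg) "x 1 \<le> x 0" "x 0 < 0" by linarith
  then show ?thesis
  proof cases
    case rising
    then show ?thesis
      by (rule f2_apex_le_of_rising_start)
  next
    case falling_nonneg
    then have "0 \<le> R * (R * (2 - R) * x 0 + (x 0 - x 1))"
      using R_pos R_less_1 by simp
    then show ?thesis
      using spiral1_le[of 3] by (simp add: x_3 power2_eq_square algebra_simps)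
  next
    case falling_neg
    then have "0 \<le> R * ((1 + R) * (x 0 - x 1) + R\<^sup>2 * (- x 0))"
      using R_pos by (intro mult_nonneg_nonneg add_nonneg_nonneg) auto
    then show ?thesis
      using spiral1_le[of 1] by (simp add: power2_eq_square algebra_simps)
  qed
qed

end

section \<open>The vertices of the convex hull\<close>

locale dragon_curve =
  fixes \<eta> :: real
  assumes \<eta>_pos: "0 < \<eta>" and \<eta>_less: "\<eta> < pi / 3"
begin

abbreviation a :: complex where "a \<equiv> dragon_a \<eta>"
abbreviation f1 :: "complex \<Rightarrow> complex" where "f1 \<equiv> dragon_f1 \<eta>"
abbreviation f2 :: "complex \<Rightarrow> complex" where "f2 \<equiv> dragon_f2 \<eta>"

definition R :: real where "R = (norm a)\<^sup>2"

lemma cos_\<eta>_gt_half: "1 / 2 < cos \<eta>"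
  using cos_monotone_0_pi[of \<eta> "pi / 3"] \<eta>_pos \<eta>_less by (simp add: cos_60)

lemma Re_a: "Re a = 1 / 2"
  using cos_\<eta>_gt_half by (simp add: dragon_a_def)

lemma Im_a: "Im a \<noteq> 0"
  using cos_\<eta>_gt_half sin_gt_zero[of \<eta>] \<eta>_pos \<eta>_less by (simp add: dragon_a_def)

lemma norm_a: "norm a < 1"
  using cos_\<eta>_gt_half by (simp add: dragon_a_def norm_divide)

lemma R_pos: "0 < R"
  using Im_a by (auto simp: R_def)

lemma R_less_1: "R < 1"
  unfolding R_def using norm_a by (simp add: power_less_one_iff)

lemma R_square_less_1: "R\<^sup>2 < 1"
  using R_pos R_less_1 by (simp add: power_less_one_iff)

lemma cnj_a: "cnj a = 1 - a"
  by (simp add: complex_eq_iff Re_a)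

lemma cnj_a_mult_a: "cnj a * a = of_real R"
  using complex_norm_square[of a] by (simp add: R_def mult.commute)

lemma a_square: "a * a = a - of_real R"
  using cnj_a_mult_a by (simp add: cnj_a algebra_simps)

lemma inner_power_recurrence:
  "u \<bullet> a ^ Suc (Suc k) = u \<bullet> a ^ Suc k - R * (u \<bullet> a ^ k)"
proof -
  have "a ^ Suc (Suc k) = (a - of_real R) * a ^ k"
    by (simp flip: a_square)
  then have "a ^ Suc (Suc k) = a ^ Suc k - R *\<^sub>R a ^ k"
    by (simp add: algebra_simps scaleR_conv_of_real)
  then show ?thesis
    by (simp only: inner_diff_right inner_scaleR_right)
qed

text \<open>\<open>spiral0 0\<close> is the fixed point of \<open>f2 \<circ> f2 \<circ> f1 \<circ> f1\<close>, and the other vertices are its images under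
  \<open>f1 ^^ n\<close>, \<open>f2 \<circ> f1 ^^ n\<close> and \<open>f2 \<circ> f2 \<circ> f1\<close>.\<close>

definition spiral0 :: "nat \<Rightarrow> complex" where
  "spiral0 n = (1 / (1 - R\<^sup>2)) *\<^sub>R a ^ Suc n"

definition spiral1 :: "nat \<Rightarrow> complex" where
  "spiral1 n = 1 - (R / (1 - R\<^sup>2)) *\<^sub>R a ^ n"

definition apex :: complex where
  "apex = a + (R\<^sup>2 / (1 - R\<^sup>2)) *\<^sub>R 1"

definition vertices :: "complex set" where
  "vertices = range spiral0 \<union> range spiral1 \<union> {apex}"

lemma spiral0_mem: "spiral0 n \<in> vertices"
  and spiral1_mem: "spiral1 n \<in> vertices"
  and apex_mem: "apex \<in> vertices"
  by (auto simp: vertices_def)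

lemma f1_spiral0: "f1 (spiral0 n) = spiral0 (Suc n)"
  by (simp add: dragon_f1_def spiral0_def)

lemma f2_spiral0: "f2 (spiral0 n) = spiral1 n"
proof -
  have "f2 (spiral0 n) = 1 - (1 / (1 - R\<^sup>2)) *\<^sub>R ((cnj a * a) * a ^ n)"
    by (simp add: dragon_f2_def spiral0_def)
  then show ?thesis
    by (simp only: cnj_a_mult_a) (simp add: spiral1_def scaleR_conv_of_real)
qed

lemma f1_spiral1: "f1 (spiral1 n) = a - (R / (1 - R\<^sup>2)) *\<^sub>R a ^ Suc n"
  by (simp add: dragon_f1_def spiral1_def algebra_simps)

lemma f2_spiral1_0: "f2 (spiral1 0) = a + (R / (1 - R\<^sup>2)) *\<^sub>R (1 - a)"
  by (simp add: dragon_f2_def spiral1_def cnj_a algebra_simps)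

lemma f2_spiral1_Suc: "f2 (spiral1 (Suc n)) = a + (R\<^sup>2 / (1 - R\<^sup>2)) *\<^sub>R a ^ n"
proof -
  have "f2 (spiral1 (Suc n)) = 1 - cnj a + (R / (1 - R\<^sup>2)) *\<^sub>R ((cnj a * a) * a ^ n)"
    by (simp add: dragon_f2_def spiral1_def algebra_simps)
  then show ?thesis
    by (simp only: cnj_a_mult_a) (simp add: cnj_a scaleR_conv_of_real power2_eq_square)
qed

lemma f2_spiral1_1: "f2 (spiral1 1) = apex"
  using f2_spiral1_Suc[of 0] by (simp add: apex_def)

lemma f2_spiral1_Suc_Suc:
  "f2 (spiral1 (Suc (Suc n))) = (1 - R\<^sup>2) *\<^sub>R spiral0 0 + R\<^sup>2 *\<^sub>R spiral0 n"
  using R_square_less_1 by (simp add: f2_spiral1_Suc spiral0_def)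

lemma f1_apex: "f1 apex = (1 - R\<^sup>2) *\<^sub>R spiral0 1 + R\<^sup>2 *\<^sub>R spiral0 0"
  using R_square_less_1 by (simp add: dragon_f1_def apex_def spiral0_def algebra_simps)

lemma f2_apex: "f2 apex = (1 - R) *\<^sub>R 1 - (R\<^sup>2 / (1 - R\<^sup>2)) *\<^sub>R (1 - a)"
proof -
  have "f2 apex = 1 - cnj a * a - (R\<^sup>2 / (1 - R\<^sup>2)) *\<^sub>R cnj a"
    by (simp add: dragon_f2_def apex_def algebra_simps)
  then show ?thesis
    by (simp only: cnj_a_mult_a) (simp add: cnj_a scaleR_conv_of_real)
qed

lemma spiral0_eq: "spiral0 = (\<lambda>n. 0 + (of_real (1 / (1 - R\<^sup>2)) * a) * a ^ n)"
  by (rule ext) (simp add: spiral0_def scaleR_conv_of_real)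

lemma spiral1_eq: "spiral1 = (\<lambda>n. 1 + of_real (- R / (1 - R\<^sup>2)) * a ^ n)"
  by (rule ext) (simp add: spiral1_def scaleR_conv_of_real)

lemma spiral0_coefficient_nonzero: "of_real (1 / (1 - R\<^sup>2)) * a \<noteq> 0"
  unfolding mult_eq_0_iff of_real_eq_0_iff using Im_a R_square_less_1 by auto

lemma spiral1_coefficient_nonzero: "complex_of_real (- R / (1 - R\<^sup>2)) \<noteq> 0"
  unfolding of_real_eq_0_iff using R_pos R_square_less_1 by auto

lemma zero_interior_hull_vertices: "0 \<in> interior (convex hull vertices)"
proof -
  have "0 \<in> interior (convex hull (range spiral0))"
    unfolding spiral0_eq
    by (intro spiral_center_interior_convex_hull Im_a spiral0_coefficient_nonzero)
  moreover have "convex hull (range spiral0) \<subseteq> convex hull vertices"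
    by (intro hull_mono) (auto simp: vertices_def)
  ultimately show ?thesis
    using interior_mono by blast
qed

lemma polytope_hull_vertices: "polytope (convex hull vertices)"
proof -
  have "polytope (convex hull (range spiral0))"
    unfolding spiral0_eq
    by (intro polytope_convex_hull_spiral Im_a norm_a spiral0_coefficient_nonzero)
  moreover have "polytope (convex hull (range spiral1))"
    unfolding spiral1_eq
    by (intro polytope_convex_hull_spiral Im_a norm_a spiral1_coefficient_nonzero)
  moreover have "polytope (convex hull {apex})"
    by (rule polytope_convex_hull) simp
  ultimately show ?thesis
    unfolding vertices_def by (intro polytope_convex_hull_Un)
qed

section \<open>Invariance of the convex hull\<close>

lemma dragon_support_half_plane:
  assumes half_plane: "\<And>z. z \<in> vertices \<Longrightarrow> u \<bullet> z \<le> c"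
  shows "dragon_support R ((1 - R\<^sup>2) * c) (\<lambda>k. u \<bullet> a ^ k)"
proof
  have scaled: "(1 - R\<^sup>2) * (u \<bullet> z) \<le> (1 - R\<^sup>2) * c" if "z \<in> vertices" for z
    using half_plane[OF that] R_square_less_1 by simp
  show "0 < R" "R < 1"
    by (fact R_pos R_less_1)+
  show "u \<bullet> a ^ Suc (Suc k) = u \<bullet> a ^ Suc k - R * (u \<bullet> a ^ k)" for k
    by (rule inner_power_recurrence)
  have "convex hull vertices \<subseteq> {z. u \<bullet> z \<le> c}"
    using half_plane by (intro hull_minimal) (auto simp: convex_halfspace_le)
  then have "u \<bullet> 0 \<le> c"
    using zero_interior_hull_vertices interior_subset by blast
  then show "0 \<le> (1 - R\<^sup>2) * c"
    using R_square_less_1 by simp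
  show "u \<bullet> a ^ Suc k \<le> (1 - R\<^sup>2) * c" for k
    using scaled[OF spiral0_mem[of k]] R_square_less_1 by (simp add: spiral0_def)
  show "(1 - R\<^sup>2) * (u \<bullet> a ^ 0) - R * (u \<bullet> a ^ k) \<le> (1 - R\<^sup>2) * c" for k
    using scaled[OF spiral1_mem[of k]] R_square_less_1
    by (simp add: spiral1_def inner_diff_right right_diff_distrib)
  show "(1 - R\<^sup>2) * (u \<bullet> a ^ 1) + R\<^sup>2 * (u \<bullet> a ^ 0) \<le> (1 - R\<^sup>2) * c"
    using scaled[OF apex_mem] R_square_less_1
    by (simp add: apex_def inner_add_right distrib_left)
qed

lemma mem_hull_vertices_by_support:
  assumes "\<And>u M. dragon_support R M (\<lambda>k. u \<bullet> a ^ k) \<Longrightarrow> (1 - R\<^sup>2) * (u \<bullet> y) \<le> M"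
  shows "y \<in> convex hull vertices"
proof (rule mem_closed_convex_hullI)
  show "closed (convex hull vertices)"
    by (intro polytope_imp_closed polytope_hull_vertices)
  show "u \<bullet> y \<le> c" if "\<And>z. z \<in> vertices \<Longrightarrow> u \<bullet> z \<le> c" for u c
    using assms[OF dragon_support_half_plane[OF that]] R_square_less_1 by simp
qed

lemma f1_spiral1_mem: "f1 (spiral1 n) \<in> convex hull vertices"
proof (rule mem_hull_vertices_by_support)
  fix u M assume "dragon_support R M (\<lambda>k. u \<bullet> a ^ k)"
  then interpret dragon_support R M "\<lambda>k. u \<bullet> a ^ k" .
  show "(1 - R\<^sup>2) * (u \<bullet> f1 (spiral1 n)) \<le> M"
    using f1_spiral1_le[of n] R_square_less_1
    by (simp add: f1_spiral1 inner_diff_right right_diff_distrib)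
qed

lemma f2_spiral1_0_mem: "f2 (spiral1 0) \<in> convex hull vertices"
proof (rule mem_hull_vertices_by_support)
  fix u M assume "dragon_support R M (\<lambda>k. u \<bullet> a ^ k)"
  then interpret dragon_support R M "\<lambda>k. u \<bullet> a ^ k" .
  show "(1 - R\<^sup>2) * (u \<bullet> f2 (spiral1 0)) \<le> M"
    using f2_spiral1_0_le R_square_less_1
    by (simp add: f2_spiral1_0 inner_add_right inner_diff_right distrib_left)
qed

lemma f2_apex_mem: "f2 apex \<in> convex hull vertices"
proof (rule mem_hull_vertices_by_support)
  fix u M assume "dragon_support R M (\<lambda>k. u \<bullet> a ^ k)"
  then interpret dragon_support R M "\<lambda>k. u \<bullet> a ^ k" .
  show "(1 - R\<^sup>2) * (u \<bullet> f2 apex) \<le> M"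
    using f2_apex_le R_square_less_1
    by (simp add: f2_apex inner_diff_right right_diff_distrib flip: mult.assoc)
qed

lemma convex_combination_mem:
  assumes "z \<in> vertices" "w \<in> vertices"
  shows "(1 - R\<^sup>2) *\<^sub>R z + R\<^sup>2 *\<^sub>R w \<in> convex hull vertices"
  using R_square_less_1 by (intro convexD_alt[OF convex_convex_hull] hull_inc assms) auto

lemma f1_image_vertices: "f1 ` vertices \<subseteq> convex hull vertices"
proof -
  have "f1 (spiral0 n) \<in> convex hull vertices" for n
    by (simp add: f1_spiral0 hull_inc spiral0_mem)
  moreover have "f1 apex \<in> convex hull vertices"
    unfolding f1_apex by (intro convex_combination_mem spiral0_mem)
  ultimately show ?thesis
    using f1_spiral1_mem by (auto simp: vertices_def)
qed

lemma f2_image_vertices: "f2 ` vertices \<subseteq> convex hull vertices"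
proof -
  have "f2 (spiral0 n) \<in> convex hull vertices" for n
    by (simp add: f2_spiral0 hull_inc spiral1_mem)
  moreover have "f2 (spiral1 n) \<in> convex hull vertices" for n
  proof -
    consider (zero) "n = 0" | (one) "n = 1" | (Suc_Suc) k where "n = Suc (Suc k)"
      by (metis One_nat_def not0_implies_Suc)
    then show ?thesis
    proof cases
      case zero
      then show ?thesis
        by (simp add: f2_spiral1_0_mem)
    next
      case one
      then show ?thesis
        using f2_spiral1_1 by (simp add: hull_inc apex_mem)
    next
      case Suc_Suc
      show ?thesis
        unfolding Suc_Suc f2_spiral1_Suc_Suc by (intro convex_combination_mem spiral0_mem)
    qed
  qed
  ultimately show ?thesis
    using f2_apex_mem by (auto simp: vertices_def)
qed

section \<open>The convex hull of the dragon curve\<close>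

lemma contractive_ifs_dragon: "contractive_ifs {f1, f2}"
proof -
  have "(norm a)-lipschitz_on UNIV f1"
    by (rule lipschitz_onI) (simp_all add: dragon_f1_def dist_norm norm_mult flip: right_diff_distrib)
  moreover have "(norm a)-lipschitz_on UNIV f2"
  proof (rule lipschitz_onI)
    fix x y
    have "f2 x - f2 y = cnj a * (y - x)"
      by (simp add: dragon_f2_def algebra_simps)
    then show "dist (f2 x) (f2 y) \<le> norm a * dist x y"
      by (simp add: dist_norm norm_mult norm_minus_commute)
  qed simp
  ultimately show ?thesis
    using norm_a by (auto simp: contractive_ifs_def)
qed

lemma attractor_dragon: "attractor {f1, f2} (dragon \<eta>)"
proof -
  have "dragon \<eta> = (THE K. attractor {f1, f2} K)"
    by (simp add: dragon_def attractor_def)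
  then show ?thesis
    using theI'[OF attractor_ex1[OF contractive_ifs_dragon]] by simp
qed

lemma f2_f2_f1_f1: "f2 (f2 (f1 (f1 z))) = a + of_real (R\<^sup>2) * z"
proof -
  have "f2 (f2 (f1 (f1 z))) = 1 - cnj a + (cnj a * a) * (cnj a * a) * z"
    by (simp add: dragon_f1_def dragon_f2_def algebra_simps)
  then show ?thesis
    by (simp only: cnj_a_mult_a) (simp add: cnj_a power2_eq_square)
qed

lemma vertices_subset_dragon: "vertices \<subseteq> dragon \<eta>"
proof -
  let ?h = "\<lambda>z. f2 (f2 (f1 (f1 z)))"
  have f1: "f1 z \<in> dragon \<eta>" and f2: "f2 z \<in> dragon \<eta>" if "z \<in> dragon \<eta>" for z
    using that attractor_image_subset[OF attractor_dragon] by auto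
  have "(R\<^sup>2)-lipschitz_on UNIV ?h"
    unfolding f2_f2_f1_f1
    by (rule lipschitz_onI) (simp_all add: dist_norm norm_mult norm_power flip: right_diff_distrib)
  moreover have "?h (spiral0 0) = spiral0 0"
    by (simp add: f1_spiral0 f2_spiral0 f2_spiral1_Suc_Suc flip: scaleR_left_distrib)
  ultimately have "spiral0 0 \<in> dragon \<eta>"
    using R_square_less_1 attractor_imp_closed[OF attractor_dragon]
      attractor_nonempty[OF attractor_dragon] f1 f2
    by (intro fixed_point_mem_closed_invariant[of "R\<^sup>2" ?h]) auto
  then have spiral0: "spiral0 n \<in> dragon \<eta>" for n
    by (induction n) (auto simp: f1 simp flip: f1_spiral0)
  then have spiral1: "spiral1 n \<in> dragon \<eta>" for n
    using f2[OF spiral0[of n]] by (simp add: f2_spiral0)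
  have "apex \<in> dragon \<eta>"
    using f2[OF spiral1[of 1]] by (simp only: f2_spiral1_1)
  then show ?thesis
    using spiral0 spiral1 by (auto simp: vertices_def)
qed

lemma hull_dragon_eq_hull_vertices: "convex hull (dragon \<eta>) = convex hull vertices"
proof (rule convex_hull_attractor_eq[OF contractive_ifs_dragon _ attractor_dragon])
  show "linear (\<lambda>z. f z - f 0)" if "f \<in> {f1, f2}" for f
    using that linear_times[of a] linear_times[of "- cnj a"]
    by (auto simp: dragon_f1_def dragon_f2_def)
  show "vertices \<noteq> {}" "vertices \<subseteq> dragon \<eta>"
    using apex_mem vertices_subset_dragon by auto
  show "closed (convex hull vertices)"
    by (intro polytope_imp_closed polytope_hull_vertices)
  show "f ` vertices \<subseteq> convex hull vertices" if "f \<in> {f1, f2}" for f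
    using that f1_image_vertices f2_image_vertices by blast
qed

end

theorem theorem1p2:
  fixes \<eta> :: real
  assumes "0 < \<eta>" and "\<eta> < pi / 3"
  shows "convex_polygon (convex hull (dragon \<eta>))"
proof -
  interpret dragon_curve \<eta>
    using assms by unfold_locales
  have "polytope (convex hull (dragon \<eta>))" "interior (convex hull (dragon \<eta>)) \<noteq> {}"
    unfolding hull_dragon_eq_hull_vertices
    using polytope_hull_vertices zero_interior_hull_vertices by auto
  then show ?thesis
    by (simp add: convex_polygon_def)
qed

end
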